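(* Let $m\ge 3$ and $s=\lfloor\frac{m+1}{2}\rfloor$. Then $$\mathcal{G}(\mathcal{H}_m) = \mathrm{mex}\{x_3,x_4,\dots,x_s,y_3,y_4,\dots,y_s\},$$ where $x_i=\mathcal{G}(\mathcal{H}_i) \oplus \mathcal{G}(\mathcal{H}_{m+1-i})$ and $y_i=\mathcal{G}(\mathcal{D}_i)\oplus \mathcal{G}(\mathcal{D}_{m+1-i})$ for $i \in \{3,4,\dots,s\}$.
   Context: Toggle: Let $G$ be a finite simple graph, with $N[v]$ the closed neighborhood of $v$. A position $\{G,V_0\}$ consists of $G$ and a set $V_0\subseteq V(G)$ of vertices of weight $0$; all other vertices have weight $1$. Let $\sigma(v)$ be the sum of the weights of the vertices in $N[v]$. A legal move consists of choosing a vertex $v$ of weight $1$ and switching the weight ($0\leftrightarrow 1$) of every vertex of $N[v]$; it is allowed only if $\sigma(v)$ after the switch is strictly smaller than $\sigma(v)$ before it. Two players alternate legal moves; a player with no legal move loses. Nimbers: $\mathcal{G}(\mathcal{S})=\mathrm{mex}\{\mathcal{G}(\mathcal{S}') : \mathcal{S}' \text{ reachable from } \mathcal{S} \text{ by one legal move}\}$, where $\mathrm{mex}(T)$ is the least nonnegative integer not in the finite set $T$ (so $\mathrm{mex}(\emptyset)=0$; lists with upper index less than $3$ are empty). $\oplus$ denotes bitwise XOR of nonnegative integers. $\mathcal{L}_{2,m}$ is the $2\times m$ grid graph with vertices $v_{i,j}$, $0\le i\le 1$, $1\le j\le m$, with edges $v_{0,j}v_{1,j}$ and $v_{i,j}v_{i,j+1}$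 ($1\le j<m$). For $m\ge 4$, $\mathcal{H}_m=\{\mathcal{L}_{2,m},V_0\}$ with $V_0=\{v_{0,1},v_{0,m},v_{1,1},v_{1,2},v_{1,m-1},v_{1,m}\}$; $\mathcal{H}_3=\{\mathcal{L}_{2,3},V_0\}$ with $V_0=\{v_{0,1},v_{0,3},v_{1,1},v_{1,3}\}$. For $m\ge 3$, $\mathcal{D}_m=\{\mathcal{L}_{2,m},V_0\}$ with $V_0=\{v_{0,1},v_{0,m-1},v_{0,m},v_{1,1},v_{1,2},v_{1,m}\}$. *)

theory Defs
  imports "Graph_Theory.Pair_Digraph"
begin

text \<open>
  Finite simple graphs are the \<^locale>\<open>pair_graph\<close>s of \<open>Graph_Theory\<close>, i.e. finite, loop-free,
  symmetric digraphs: an edge between \<open>u\<close> and \<open>v\<close> is the pair of arcs \<open>(u, v)\<close>, \<open>(v, u)\<close>.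
\<close>

definition closed_nbhd :: "'a pair_pre_digraph \<Rightarrow> 'a \<Rightarrow> 'a set" where
  "closed_nbhd G v = insert v {u. (v, u) \<in> parcs G}"

section \<open>The game Toggle\<close>

text \<open>The pair \<open>(G, V0)\<close> is the position in which exactly the vertices in \<open>V0\<close> have weight 0.\<close>

type_synonym 'a position = "'a pair_pre_digraph \<times> 'a set"

definition toggle_position :: "'a position \<Rightarrow> bool" where
  "toggle_position = (\<lambda>(G, V0). pair_graph G \<and> V0 \<subseteq> pverts G)"

definition weight :: "'a position \<Rightarrow> 'a \<Rightarrow> nat" where
  "weight = (\<lambda>(G, V0) v. if v \<in> V0 then 0 else 1)"

definition sigma :: "'a position \<Rightarrow> 'a \<Rightarrow> nat" where
  "sigma p v = (\<Sum>u\<in>closed_nbhd (fst p) v. weight p u)"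

definition switch :: "'a position \<Rightarrow> 'a \<Rightarrow> 'a position" where
  "switch = (\<lambda>(G, V0) v. (G, sym_diff V0 (closed_nbhd G v)))"

definition legal_move :: "'a position \<Rightarrow> 'a position \<Rightarrow> bool" where
  "legal_move p q \<longleftrightarrow>
    (\<exists>v\<in>pverts (fst p). weight p v = 1 \<and> q = switch p v \<and> sigma q v < sigma p v)"

section \<open>Nimbers\<close>

definition mex :: "nat set \<Rightarrow> nat" where
  "mex T = (LEAST n. n \<notin> T)"

lemma closed_nbhd_subset:
  assumes "pair_graph G" "v \<in> pverts G"
  shows "closed_nbhd G v \<subseteq> pverts G"
proof -
  interpret pair_graph G by fact
  show ?thesis using assms(2) by (auto simp: closed_nbhd_def dest: in_arcsD2)
qed

lemma fst_legal_move: "legal_move p q \<Longrightarrow> fst q = fst p"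
  by (auto simp: legal_move_def switch_def split: prod.splits)

lemma toggle_position_legal_move:
  assumes "toggle_position p" "legal_move p q"
  shows "toggle_position q"
proof -
  obtain G V0 where pG: "p = (G, V0)" by (cases p)
  from assms obtain v where v: "v \<in> pverts G" "q = switch p v" and G: "pair_graph G" "V0 \<subseteq> pverts G"
    by (auto simp: legal_move_def toggle_position_def pG)
  from closed_nbhd_subset[OF G(1) v(1)] G show ?thesis
    unfolding v(2) by (simp add: pG switch_def toggle_position_def) blast
qed

lemma total_weight_legal_move:
  assumes p: "toggle_position p" and m: "legal_move p q"
  shows "(\<Sum>u\<in>pverts (fst q). weight q u) < (\<Sum>u\<in>pverts (fst p). weight p u)"
proof -
  obtain G V0 where pG: "p = (G, V0)" by (cases p)
  interpret pair_graph G using p by (simp add: pG toggle_position_def)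
  from m obtain v where v: "v \<in> pverts G" "q = switch p v" "sigma q v < sigma p v"
    unfolding legal_move_def pG fst_conv by blast
  let ?N = "closed_nbhd G v"
  have N: "?N \<subseteq> pverts G" by (rule closed_nbhd_subset[OF pair_graph v(1)])
  have split: "(\<Sum>u\<in>pverts G. f u) = (\<Sum>u\<in>pverts G - ?N. f u) + (\<Sum>u\<in>?N. f u)" for f :: "_ \<Rightarrow> nat"
    using N pair_finite_verts by (rule sum.subset_diff)
  have "(\<Sum>u\<in>pverts G - ?N. weight q u) = (\<Sum>u\<in>pverts G - ?N. weight p u)"
    by (rule sum.cong) (auto simp: v(2) pG switch_def weight_def)
  with v(3) show ?thesis
    by (simp add: sigma_def fst_legal_move[OF m] pG split)
qed

text \<open>
  Nimbers are defined on genuine positions, where the total weight decreases with each move;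
  the value 0 on other arguments is a dummy.
\<close>

context
  notes image_cong [fundef_cong]
begin

function nimber :: "'a position \<Rightarrow> nat" where
  "nimber p = (if toggle_position p then mex (nimber ` {q. legal_move p q}) else 0)"
  by auto
termination
  by (relation "measure (\<lambda>p. \<Sum>u\<in>pverts (fst p). weight p u)")
     (auto dest: total_weight_legal_move)

end

declare nimber.simps [simp del]

lemma nimber_eq:
  "toggle_position p \<Longrightarrow> nimber p = mex {nimber q |q. legal_move p q}"
  by (simp only: nimber.simps[of p] if_True) (simp add: image_Collect)

section \<open>The positions on ladders\<close>

text \<open>The vertex \<open>v\<^sub>i\<^sub>,\<^sub>j\<close> is the pair \<open>(i, j)\<close>.\<close>

definition ladder_edges :: "nat \<Rightarrow> (nat \<times> nat) rel" where
  "ladder_edges m =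
    {((0, j), (1, j)) |j. 1 \<le> j \<and> j \<le> m} \<union>
    {((i, j), (i, j + 1)) |i j. i \<le> 1 \<and> 1 \<le> j \<and> j < m}"

definition ladder :: "nat \<Rightarrow> (nat \<times> nat) pair_pre_digraph" where
  "ladder m = \<lparr>pverts = {0..1} \<times> {1..m}, parcs = ladder_edges m \<union> (ladder_edges m)\<inverse>\<rparr>"

text \<open>Meant for \<open>m \<ge> 3\<close> only.\<close>

definition H_pos :: "nat \<Rightarrow> (nat \<times> nat) position" where
  "H_pos m =
    (ladder m,
     if m = 3 then {(0, 1), (0, 3), (1, 1), (1, 3)}
     else {(0, 1), (0, m), (1, 1), (1, 2), (1, m - 1), (1, m)})"

definition D_pos :: "nat \<Rightarrow> (nat \<times> nat) position" where
  "D_pos m = (ladder m, {(0, 1), (0, m - 1), (0, m), (1, 1), (1, 2), (1, m)})"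

lemma pair_graph_ladder: "pair_graph (ladder m)"
proof
  have sub: "parcs (ladder m) \<subseteq> pverts (ladder m) \<times> pverts (ladder m)"
    by (auto simp: ladder_def ladder_edges_def)
  show "finite (pverts (ladder m))" by (simp add: ladder_def)
  then show "finite (parcs (ladder m))" using sub by (meson finite_SigmaI finite_subset)
  show "fst e \<in> pverts (ladder m)" "snd e \<in> pverts (ladder m)"
    if "e \<in> parcs (ladder m)" for e using sub that by auto
  show "fst e \<noteq> snd e" if "e \<in> parcs (ladder m)" for e
    using that by (auto simp: ladder_def ladder_edges_def)
  show "symmetric (with_proj (ladder m))"
    by (auto simp: symmetric_def sym_def ladder_def)
qed

lemma toggle_position_H_pos: "m \<ge> 3 \<Longrightarrow> toggle_position (H_pos m)"
  by (auto simp: toggle_position_def H_pos_def pair_graph_ladder) (auto simp: ladder_def)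

lemma toggle_position_D_pos: "m \<ge> 3 \<Longrightarrow> toggle_position (D_pos m)"
  by (auto simp: toggle_position_def D_pos_def pair_graph_ladder) (auto simp: ladder_def)

end

theory Submission
  imports Defs
begin

text \<open>
  Switching a set \<open>M\<close> of vertices of the all-ones ladder, \<open>H\<^sub>m\<close> arises from \<open>M = {v\<^sub>1\<^sub>,\<^sub>1, v\<^sub>1\<^sub>,\<^sub>m}\<close> and
  \<open>D\<^sub>m\<close> from \<open>M = {v\<^sub>1\<^sub>,\<^sub>1, v\<^sub>0\<^sub>,\<^sub>m}\<close>, also for \<open>m = 3\<close>. As long as the columns of \<open>M\<close> are pairwise at
  distance at least 2 and include the first and the last one, a move is legal iff it adds to \<open>M\<close> a
  vertex whose column is at distance at least 2 from all columns of \<open>M\<close>, with one exception. So every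
  reachable position is a chain of blocks \<open>H\<close> and \<open>D\<close> (up to reflection) sharing their end columns,
  and a move splits one block into two. Hence the nimber of a chain is the nim-sum of block values
  given by the recursion of the theorem. The exception, splitting \<open>H\<^sub>5\<close> into two copies of \<open>H\<^sub>3\<close>, is
  harmless: its value 0 is also attained by the legal split of \<open>H\<^sub>5\<close> into two copies of \<open>D\<^sub>3\<close>.
\<close>

section \<open>Minimal excluded values and nim-sums\<close>

definition is_mex :: "nat \<Rightarrow> nat set \<Rightarrow> bool" where
  "is_mex n T \<longleftrightarrow> n \<notin> T \<and> {..<n} \<subseteq> T"

lemma mex_eqI: "is_mex n T \<Longrightarrow> mex T = n"
  unfolding mex_def is_mex_def by (rule Least_equality) (auto simp: not_less[symmetric])

lemma is_mex_mex: "finite T \<Longrightarrow> is_mex (mex T) T"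
  unfolding mex_def is_mex_def
  using ex_new_if_finite[OF infinite_UNIV_nat, of T]
  by (metis (no_types, lifting) LeastI lessThan_iff not_less_Least subsetI)

text \<open>Induction on binary digits: with the last bit dropped, either the inequality stays
  strict, or the last bits decide and exactly one of \<open>a\<close>, \<open>b\<close> is
  odd.\<close>

lemma less_xor_nat_cases:
  fixes a b t :: nat
  assumes "t < xor a b"
  shows "xor t b < a \<or> xor a t < b"
  using assms
proof (induction a arbitrary: b t rule: less_induct)
  case (less a)
  have div: "xor x y div 2 = xor (x div 2) (y div 2)" for x y :: nat
    by (rule bit_eqI) (simp add: bit_xor_iff flip: bit_Suc)
  have lt: "x < y \<longleftrightarrow> x div 2 < y div 2 \<or> x div 2 = y div 2 \<and> even x \<and> odd y" for x y :: nat
    by presburger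
  show ?case
  proof (cases "a = 0")
    case True
    with less.prems show ?thesis by simp
  next
    case False
    consider "t div 2 < xor (a div 2) (b div 2)"
      | "t div 2 = xor (a div 2) (b div 2)" "even t" "odd (xor a b)"
      using less.prems unfolding lt[of t] div by blast
    then show ?thesis
    proof cases
      case 1
      have "a div 2 < a" using False by simp
      from less.IH[OF this 1] show ?thesis
        unfolding lt[of _ a] lt[of _ b] div by blast
    next
      case 2
      have "xor (t div 2) (b div 2) = a div 2" "xor (a div 2) (t div 2) = b div 2"
        by (simp_all add: 2(1) xor.assoc flip: xor.assoc[of "a div 2" "a div 2"])
      then show ?thesis
        using 2(2,3) unfolding lt[of _ a] lt[of _ b] div by (auto simp: even_xor_iff)
    qed
  qed
qed

lemma xor_left_cancel_nat: "xor a b = xor a c \<longleftrightarrow> b = c" for a b c :: nat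
  by (metis xor.assoc xor.left_neutral xor_self_eq)

lemma xor_right_cancel_nat: "xor b a = xor c a \<longleftrightarrow> b = c" for a b c :: nat
  by (metis xor.commute xor_left_cancel_nat)

text \<open>The Sprague-Grundy rule for sums: cancellation keeps \<open>xor a b\<close> out of the
  option values, and \<open>less_xor_nat_cases\<close> makes every smaller value an option.\<close>

lemma is_mex_xor:
  assumes S: "is_mex a S" and T: "is_mex b T"
  shows "is_mex (xor a b) ((\<lambda>s. xor s b) ` S \<union> xor a ` T)"
  unfolding is_mex_def
proof (intro conjI subsetI)
  show "xor a b \<notin> (\<lambda>s. xor s b) ` S \<union> xor a ` T"
    using S T by (auto simp: is_mex_def xor_left_cancel_nat xor_right_cancel_nat)
next
  fix t assume "t \<in> {..<xor a b}"
  then consider "xor t b \<in> S" | "xor a t \<in> T"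
    using less_xor_nat_cases[of t a b] S T by (auto simp: is_mex_def)
  then show "t \<in> (\<lambda>s. xor s b) ` S \<union> xor a ` T"
  proof cases
    case 1
    have "t = xor (xor t b) b" by (simp add: xor.assoc)
    with 1 show ?thesis by blast
  next
    case 2
    have "t = xor a (xor a t)" by (simp flip: xor.assoc)
    with 2 show ?thesis by blast
  qed
qed

section \<open>The values of chains of blocks\<close>

context
  notes image_cong [fundef_cong]
begin

text \<open>
  \<open>block_value True g\<close> and \<open>block_value False g\<close> turn out to be the nimbers of
  \<open>H\<close> and \<open>D\<close> on \<open>g + 1\<close> columns.
\<close>

function block_value :: "bool \<Rightarrow> nat \<Rightarrow> nat" where
  "block_value e g =
    mex ((\<lambda>(f, a). xor (block_value f a) (block_value (f = e) (g - a))) ` (UNIV \<times> {2..g - 2}))"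
  by auto
termination
  by (relation "measure snd") auto

end

declare block_value.simps [simp del]

text \<open>Consecutive switched vertices bound a block, \<open>H\<close> if they share a row and
  \<open>D\<close> otherwise. Its size is the column difference, so sizes add up although blocks
  share end columns.\<close>

definition gap_value :: "nat \<times> nat \<Rightarrow> nat \<times> nat \<Rightarrow> nat" where
  "gap_value p q = block_value (fst p = fst q) (snd q - snd p)"

text \<open>
  The last clause excludes the one switch between \<open>p\<close> and \<open>q\<close> that is not legal: it would split
  \<open>H\<close> on five columns into two copies of \<open>H\<close> on three.
\<close>

definition fits :: "nat \<times> nat \<Rightarrow> nat \<times> nat \<Rightarrow> nat \<times> nat \<Rightarrow> bool" where
  "fits p w q \<longleftrightarrow> fst w \<le> 1 \<and> snd p + 2 \<le> snd w \<and> snd w + 2 \<le> snd q \<and>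
    \<not> (p = (fst w, snd w - 2) \<and> q = (fst w, snd w + 2))"

text \<open>An inner vertex \<open>w\<close> corresponds to an index of the recursion: whether it
  shares the row of \<open>p\<close>, and its distance from \<open>p\<close>.\<close>

lemma is_mex_gap_value:
  assumes "fst p \<le> 1" "fst q \<le> 1"
  shows "is_mex (gap_value p q) {xor (gap_value p w) (gap_value w q) |w. fits p w q}"
proof -
  let ?g = "snd q - snd p" and ?e = "fst p = fst q"
  let ?B = "(\<lambda>(f, a). xor (block_value f a) (block_value (f = ?e) (?g - a))) ` (UNIV \<times> {2..?g - 2})"
  have "?B = {xor (gap_value p w) (gap_value w q) |w. fits p w q}"
  proof (intro set_eqI iffI)
    fix t assume "t \<in> ?B"
    then obtain f a where fa: "2 \<le> a" "a \<le> ?g - 2"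
      "t = xor (block_value f a) (block_value (f = ?e) (?g - a))"
      by auto
    show "t \<in> {xor (gap_value p w) (gap_value w q) |w. fits p w q}"
    proof (cases "f \<and> ?e \<and> a = 2 \<and> ?g = 4")
      case True
      \<comment> \<open>The one index whose vertex does not fit. Its value is 0, a nim-sum of two
        equal block values; the vertex in the other row yields 0 as well.\<close>
      have "1 - fst p \<noteq> fst p" "snd q = snd p + 4" using True by arith+
      then have "fits p (1 - fst p, snd p + 2) q"
        using assms unfolding fits_def prod_eq_iff by auto
      moreover have "t = xor (gap_value p (1 - fst p, snd p + 2)) (gap_value (1 - fst p, snd p + 2) q)"
        using fa True \<open>1 - fst p \<noteq> fst p\<close> \<open>snd q = snd p + 4\<close> by (auto simp: gap_value_def)
      ultimately show ?thesis by blast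
    next
      case False
      have "1 - fst p \<noteq> fst p" by arith
      let ?w = "(if f then fst p else 1 - fst p, snd p + a)"
      have "fits p ?w q"
        using False fa assms \<open>1 - fst p \<noteq> fst p\<close> by (cases p; cases q) (auto simp: fits_def)
      moreover have "t = xor (gap_value p ?w) (gap_value ?w q)"
      proof -
        \<comment> \<open>With two rows only, \<open>?w\<close> and \<open>q\<close> share a row iff
          the left part has the type of the whole block.\<close>
        have "(fst ?w = fst q) = (f = ?e)" "(fst p = fst ?w) = f"
          using assms \<open>1 - fst p \<noteq> fst p\<close> by (auto simp: le_Suc_eq)
        then show ?thesis using fa by (simp add: gap_value_def)
      qed
      ultimately show ?thesis by blast
    qed
  next
    fix t assume "t \<in> {xor (gap_value p w) (gap_value w q) |w. fits p w q}"
    then obtain w where w: "fits p w q" and t: "t = xor (gap_value p w) (gap_value w q)" by blast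
    have "(fst w = fst q) = ((fst p = fst w) = ?e)" "snd q - snd w = ?g - (snd w - snd p)"
      "2 \<le> snd w - snd p" "snd w - snd p \<le> ?g - 2"
      using w assms by (auto simp: fits_def)
    then show "t \<in> ?B"
      by (intro image_eqI[of _ _ "(fst p = fst w, snd w - snd p)"]) (auto simp: t gap_value_def)
  qed
  moreover have "is_mex (gap_value p q) ?B"
    using is_mex_mex[of ?B] by (simp add: gap_value_def block_value.simps[of ?e ?g])
  ultimately show ?thesis by simp
qed

fun chain_value :: "(nat \<times> nat) list \<Rightarrow> nat" where
  "chain_value (p # q # ps) = xor (gap_value p q) (chain_value (q # ps))"
| "chain_value _ = 0"

inductive refine :: "nat \<times> nat \<Rightarrow> (nat \<times> nat) list \<Rightarrow> (nat \<times> nat) list \<Rightarrow> bool" for w where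
  here: "fits p w q \<Longrightarrow> refine w (p # q # ps) (p # w # q # ps)"
| there: "refine w (q # ps) (q # ps') \<Longrightarrow> refine w (p # q # ps) (p # q # ps')"

lemma refine_Cons_Cons_iff:
  "refine w (p # q # ps) rs \<longleftrightarrow>
    fits p w q \<and> rs = p # w # q # ps \<or> (\<exists>ps'. refine w (q # ps) (q # ps') \<and> rs = p # q # ps')"
  by (subst refine.simps) auto

lemma not_refine_simps [simp]: "\<not> refine w [] rs" "\<not> refine w [p] rs"
  by (auto elim: refine.cases)

lemma refine_Cons: "refine w (p # ps) rs \<Longrightarrow> \<exists>ps'. rs = p # ps'"
  by (auto elim: refine.cases)

text \<open>A move either splits the first block or happens further right, so
  \<open>is_mex_xor\<close> applies inductively.\<close>

lemma is_mex_chain_value: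
  assumes "\<forall>p\<in>set ps. fst p \<le> 1"
  shows "is_mex (chain_value ps) {chain_value rs |w rs. refine w ps rs}"
  using assms
proof (induction ps rule: chain_value.induct)
  case (1 p q ps)
  let ?S = "{xor (gap_value p w) (gap_value w q) |w. fits p w q}"
  let ?T = "{chain_value rs |w rs. refine w (q # ps) rs}"
  have "is_mex (chain_value (p # q # ps))
    ((\<lambda>s. xor s (chain_value (q # ps))) ` ?S \<union> xor (gap_value p q) ` ?T)"
    using is_mex_xor[OF is_mex_gap_value, of p q "chain_value (q # ps)" ?T] 1 by simp
  also have "(\<lambda>s. xor s (chain_value (q # ps))) ` ?S \<union> xor (gap_value p q) ` ?T =
      {chain_value rs |w rs. refine w (p # q # ps) rs}" (is "?L = ?R")
  proof (intro set_eqI iffI)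
    fix t assume "t \<in> ?L"
    moreover have "?T = {chain_value (q # rs) |w rs. refine w (q # ps) (q # rs)}"
      using refine_Cons by (metis (no_types, opaque_lifting))
    ultimately consider w where "fits p w q" "t = chain_value (p # w # q # ps)"
      | w rs where "refine w (q # ps) (q # rs)" "t = chain_value (p # q # rs)"
      by (auto simp: xor.assoc)
    then show "t \<in> ?R" by cases (blast intro: refine.intros)+
  next
    fix t assume "t \<in> ?R"
    then obtain w rs where "refine w (p # q # ps) rs" "t = chain_value rs" by blast
    then consider w where "fits p w q" "t = chain_value (p # w # q # ps)"
      | w rs where "refine w (q # ps) (q # rs)" "t = chain_value (p # q # rs)"
      unfolding refine_Cons_Cons_iff by blast
    then show "t \<in> ?L"
    proof cases
      case (1 w)
      then have "t = xor (xor (gap_value p w) (gap_value w q)) (chain_value (q # ps))"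
        by (simp add: xor.assoc)
      with 1(1) show ?thesis by blast
    next
      case (2 w rs)
      then have "chain_value (q # rs) \<in> ?T" by blast
      with 2(2) show ?thesis by simp
    qed
  qed
  finally show ?case .
qed (auto simp: is_mex_def)

section \<open>Positions obtained by switching the all-ones position\<close>

text \<open>Switches commute and cancel in pairs, so starting from all ones only the set of switched
  vertices matters, through parities.\<close>

definition switched :: "'a pair_pre_digraph \<Rightarrow> 'a set \<Rightarrow> 'a position" where
  "switched G M = (G, {v \<in> pverts G. odd (card (closed_nbhd G v \<inter> M))})"

lemma toggle_position_switched: "pair_graph G \<Longrightarrow> toggle_position (switched G M)"
  by (auto simp: toggle_position_def switched_def)

lemma finite_closed_nbhd:
  assumes "pair_graph G" "v \<in> pverts G"
  shows "finite (closed_nbhd G v)"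
proof -
  interpret pair_graph G by fact
  show ?thesis
    using closed_nbhd_subset[OF assms] pair_finite_verts by (rule finite_subset)
qed

lemma closed_nbhd_sym:
  assumes "pair_graph G"
  shows "v \<in> closed_nbhd G w \<longleftrightarrow> w \<in> closed_nbhd G v"
proof -
  interpret pair_graph G by fact
  show ?thesis by (auto simp: closed_nbhd_def intro: arcs_symmetric)
qed

lemma switch_switched:
  assumes G: "pair_graph G" and w: "w \<in> pverts G" "w \<notin> M"
  shows "switch (switched G M) w = switched G (insert w M)"
proof -
  have "odd (card (closed_nbhd G v \<inter> insert w M)) \<longleftrightarrow>
      odd (card (closed_nbhd G v \<inter> M)) \<noteq> (v \<in> closed_nbhd G w)"
    if "v \<in> pverts G" for v
    using finite_closed_nbhd[OF G that] w(2)
    by (simp add: closed_nbhd_sym[OF G, of v] Int_insert_right)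
  then show ?thesis
    using closed_nbhd_subset[OF G w(1)] by (auto simp: switch_def switched_def)
qed

text \<open>Each weight before and after adds up to 1. So a switch lowers the sum iff more than half
  of the closed neighborhood had weight 1.\<close>

lemma sigma_switch:
  assumes "toggle_position p" "v \<in> pverts (fst p)"
  shows "sigma (switch p v) v + sigma p v = card (closed_nbhd (fst p) v)"
proof -
  obtain G V where p: "p = (G, V)" by (cases p)
  have "sigma (switch p v) v + sigma p v =
      (\<Sum>u\<in>closed_nbhd G v. weight (switch p v) u + weight p u)"
    by (simp add: sigma_def p switch_def sum.distrib)
  also have "\<dots> = (\<Sum>u\<in>closed_nbhd G v. 1)"
    by (rule sum.cong) (auto simp: p switch_def weight_def)
  finally show ?thesis by (simp add: p)
qed

section \<open>Chains of blocks on ladders\<close>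

lemma pverts_ladder: "pverts (ladder m) = {0..1} \<times> {1..m}"
  by (simp add: ladder_def)

lemma closed_nbhd_ladder:
  assumes "i \<le> 1" "1 \<le> j" "j \<le> m"
  shows "closed_nbhd (ladder m) (i, j) =
    {(i, j), (1 - i, j), (i, j - 1), (i, j + 1)} \<inter> {0..1} \<times> {1..m}"
proof -
  have "i = 0 \<or> i = 1" using assms(1) by auto
  then show ?thesis using assms
    by (auto simp: closed_nbhd_def ladder_def ladder_edges_def)
qed

text \<open>A nested equality of four Booleans holds iff an even number of them are true. Border
  cases need no care, since \<open>M\<close> lies inside the ladder.\<close>

lemma weight_switched_ladder:
  assumes M: "M \<subseteq> {0..1} \<times> {1..m}" and v: "i \<le> 1" "1 \<le> j" "j \<le> m"
  shows "weight (switched (ladder m) M) (i, j) =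
    (if ((i, j) \<in> M) = (((1 - i, j) \<in> M) = (((i, j - 1) \<in> M) = ((i, j + 1) \<in> M))) then 1 else 0)"
proof -
  have N: "closed_nbhd (ladder m) (i, j) \<inter> M = {(i, j), (1 - i, j), (i, j - 1), (i, j + 1)} \<inter> M"
    using M by (auto simp: closed_nbhd_ladder[OF v])
  have d: "1 - i \<noteq> i" "j - 1 \<noteq> j" using v by arith+
  have "odd (card ({(i, j), (1 - i, j), (i, j - 1), (i, j + 1)} \<inter> M)) \<longleftrightarrow>
    ((i, j) \<in> M) \<noteq> (((1 - i, j) \<in> M) = (((i, j - 1) \<in> M) = ((i, j + 1) \<in> M)))"
    using d by (auto simp: Int_insert_left)
  then show ?thesis
    using v by (auto simp: weight_def switched_def pverts_ladder N)
qed

definition chain :: "nat \<Rightarrow> (nat \<times> nat) list \<Rightarrow> bool" where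
  "chain m ps \<longleftrightarrow> ps \<noteq> [] \<and> snd (hd ps) = 1 \<and> snd (last ps) = m \<and>
    (\<forall>p\<in>set ps. fst p \<le> 1) \<and> sorted_wrt (\<lambda>p q. snd p + 2 \<le> snd q) ps"

definition admissible :: "(nat \<times> nat) set \<Rightarrow> nat \<times> nat \<Rightarrow> bool" where
  "admissible M w \<longleftrightarrow> fst w \<le> 1 \<and> (\<forall>p\<in>M. snd p + 2 \<le> snd w \<or> snd w + 2 \<le> snd p) \<and>
    \<not> {(fst w, snd w - 2), (fst w, snd w + 2)} \<subseteq> M"

text \<open>Columns meeting \<open>M\<close> have weight 0, so \<open>w\<close> must lie in a free
  column. If an adjacent column meets \<open>M\<close>, the move is illegal; otherwise it is legal
  unless both horizontal neighbors have weight 0.\<close>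

lemma legal_switched_ladder_iff:
  fixes m :: nat
  defines "P \<equiv> switched (ladder m)"
  assumes M: "M \<subseteq> {0..1} \<times> {1..m}"
    and sep: "\<And>p q. p \<in> M \<Longrightarrow> q \<in> M \<Longrightarrow> p = q \<or> snd p + 2 \<le> snd q \<or> snd q + 2 \<le> snd p"
    and ends: "(a, 1) \<in> M" "(b, m) \<in> M"
    and w: "w \<in> pverts (ladder m)"
  shows "weight (P M) w = 1 \<and> sigma (switch (P M) w) w < sigma (P M) w \<longleftrightarrow> admissible M w"
proof -
  obtain i j where wij: "w = (i, j)" and i: "i \<le> 1" and j: "1 \<le> j" "j \<le> m"
    using w by (cases w) (auto simp: pverts_ladder)
  let ?W = "weight (P M)"
  note W = weight_switched_ladder[OF M, folded P_def]
  \<comment> \<open>The element of \<open>M\<close> in this column is the only one in either closed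
    neighborhood, so the parity is odd.\<close>
  have zero: "?W (i', k) = 0" if k: "(r, k) \<in> M" "i' \<le> 1" for r i' k
  proof -
    have "1 \<le> k" "k \<le> m" "r \<le> 1" using M k by auto
    moreover have "(r', l) \<notin> M" if "l = k - 1 \<or> l = k + 1" for r' l
      using sep[OF k(1), of "(r', l)"] that \<open>1 \<le> k\<close> by auto
    moreover have "1 - r \<noteq> r" by arith
    then have "(1 - r, k) \<notin> M" using sep[OF k(1), of "(1 - r, k)"] by auto
    moreover have "i' = r \<or> i' = 1 - r" "1 - (1 - r) = r" using \<open>r \<le> 1\<close> k(2) by auto
    ultimately show ?thesis using k W[of i' k] by auto
  qed
  show ?thesis
  proof (cases "\<exists>r. (r, j) \<in> M")
    case True
    then show ?thesis using zero i by (fastforce simp: wij admissible_def)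
  next
    case False
    \<comment> \<open>The end columns meet \<open>M\<close>, so a free column is inner and the
      closed neighborhood has four vertices.\<close>
    have j': "1 < j" "j < m" using False ends j by (auto simp: le_less)
    have col: "{(i, j), (1 - i, j), (i, j - 1), (i, j + 1)} \<subseteq> {0..1} \<times> {1..m}"
      using i j' by auto
    have N: "closed_nbhd (ladder m) (i, j) = {(i, j), (1 - i, j), (i, j - 1), (i, j + 1)}"
      using closed_nbhd_ladder[OF i j] col by auto
    have d: "1 - i \<noteq> i" "j - 1 \<noteq> j" "j - 1 \<noteq> j + 1" using j' by arith+
    have "toggle_position (P M)" "fst (P M) = ladder m"
      by (simp_all add: P_def toggle_position_switched pair_graph_ladder) (simp add: switched_def)
    then have "sigma (switch (P M) w) w + sigma (P M) w = 4"
      using sigma_switch[of "P M" w] w d by (simp add: wij N)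
    moreover have "sigma (P M) w = ?W (i, j) + ?W (1 - i, j) + ?W (i, j - 1) + ?W (i, j + 1)"
      using d \<open>fst (P M) = ladder m\<close> by (simp add: sigma_def wij N)
    ultimately have legal: "?W w = 1 \<and> sigma (switch (P M) w) w < sigma (P M) w \<longleftrightarrow>
        ?W (i, j) = 1 \<and> ?W (1 - i, j) + ?W (i, j - 1) + ?W (i, j + 1) \<ge> 2"
      by (auto simp: wij)
    have W_le: "?W v \<le> 1" for v by (auto simp: weight_def split: prod.splits)
    have W_j: "?W (r, j) = (if ((r, j - 1) \<in> M) = ((r, j + 1) \<in> M) then 1 else 0)"
      if "r \<le> 1" for r
      using W[OF that j] False by auto
    show ?thesis
    proof (cases "\<exists>r. (r, j - 1) \<in> M \<or> (r, j + 1) \<in> M")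
      case True
      then obtain r where r: "(r, j - 1) \<in> M \<or> (r, j + 1) \<in> M" by blast
      then have "r \<le> 1" using M by auto
      have "\<not> admissible M w"
        using r j' by (fastforce simp: admissible_def wij)
      moreover have "\<not> (?W (i, j) = 1 \<and> ?W (1 - i, j) + ?W (i, j - 1) + ?W (i, j + 1) \<ge> 2)"
      proof
        assume A: "?W (i, j) = 1 \<and> ?W (1 - i, j) + ?W (i, j - 1) + ?W (i, j + 1) \<ge> 2"
        \<comment> \<open>One horizontal neighbor has weight 0, so all else must have weight 1. Then
          column \<open>j\<close> has weight 1 in both rows, and \<open>W_j\<close> puts
          \<open>M\<close> on both sides, making both horizontal neighbors 0.\<close>
        have "?W (i, j - 1) = 0 \<or> ?W (i, j + 1) = 0"
          using r zero[of r "j - 1" i] zero[of r "j + 1" i] i by auto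
        then have B: "?W (1 - i, j) = 1" "?W (i, j - 1) \<noteq> 0 \<or> ?W (i, j + 1) \<noteq> 0"
          using A W_le[of "(1 - i, j)"] W_le[of "(i, j - 1)"] W_le[of "(i, j + 1)"] by linarith+
        have "r = i \<or> r = 1 - i" using i \<open>r \<le> 1\<close> by auto
        then have "?W (r, j) = 1" using A B(1) by auto
        then have "(r, j - 1) \<in> M \<longleftrightarrow> (r, j + 1) \<in> M"
          using W_j[OF \<open>r \<le> 1\<close>] by (metis zero_neq_one)
        then have "?W (i, j - 1) = 0" "?W (i, j + 1) = 0"
          using r i zero by blast+
        then show False using B(2) by simp
      qed
      ultimately show ?thesis using legal by blast
    next
      case free: False
      have "(i, j - 2) \<in> M \<longleftrightarrow> ?W (i, j - 1) = 0"
        using W[of i "j - 1"] i j' False free by (auto simp: numeral_2_eq_2)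
      moreover have "(i, j + 2) \<in> M \<longleftrightarrow> ?W (i, j + 1) = 0"
        using W[of i "j + 1"] i j' False free by auto
      moreover have "?W (i, j) = 1" "?W (1 - i, j) = 1"
        using W_j[of i] W_j[of "1 - i"] i free by auto
      moreover have "snd p + 2 \<le> j \<or> j + 2 \<le> snd p" if p: "p \<in> M" for p
      proof -
        have "snd p \<noteq> j" "snd p \<noteq> j - 1" "snd p \<noteq> j + 1"
          using p False free by (metis prod.collapse)+
        then show ?thesis by linarith
      qed
      ultimately show ?thesis
        unfolding legal using i by (auto simp: admissible_def wij)
    qed
  qed
qed

section \<open>Legal moves as refinements of chains\<close>

lemma set_refine: "refine w ps rs \<Longrightarrow> set rs = insert w (set ps)"
  by (induction rule: refine.induct) auto

lemma chain_refine:
  assumes "refine w ps rs" "chain m ps"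
  shows "chain m rs"
proof -
  have sorted: "sorted_wrt (\<lambda>p q. snd p + 2 \<le> snd q) ps"
    using assms(2) by (simp add: chain_def)
  have "sorted_wrt (\<lambda>p q. snd p + 2 \<le> snd q) rs"
    using assms(1) sorted
  proof (induction rule: refine.induct)
    case (there q ps ps' p)
    moreover have "w \<in> set (q # ps')" using set_refine[OF there.hyps] by simp
    ultimately show ?case using set_refine[OF there.hyps] by auto
  qed (fastforce simp: fits_def)
  moreover have "rs \<noteq> []" "hd rs = hd ps" "last rs = last ps" "fst w \<le> 1"
    using assms(1) by (induction rule: refine.induct) (auto simp: fits_def)
  ultimately show ?thesis
    using assms(2) set_refine[OF assms(1)] by (auto simp: chain_def)
qed

text \<open>Since columns increase along the chain, admissibility depends only on the vertices
  nearest to \<open>w\<close> and can be tested inside one gap.\<close>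

lemma refine_iff_admissible:
  assumes "sorted_wrt (\<lambda>p q. snd p + 2 \<le> snd q) ps" "ps \<noteq> []"
  shows "(\<exists>rs. refine w ps rs) \<longleftrightarrow>
    admissible (set ps) w \<and> snd (hd ps) < snd w \<and> snd w < snd (last ps)"
  using assms
proof (induction ps rule: chain_value.induct)
  case (1 p q ps)
  have *: "(\<exists>rs. refine w (p # q # ps) rs) \<longleftrightarrow> fits p w q \<or> (\<exists>rs. refine w (q # ps) rs)"
    unfolding refine_Cons_Cons_iff using refine_Cons by metis
  have le: "snd q \<le> snd r" if "r \<in> set (q # ps)" for r using that 1 by auto
  have lt: "snd p + 2 \<le> snd r" if "r \<in> set (q # ps)" for r using that 1 by auto
  have last: "snd q \<le> snd (last (q # ps))" by (rule le) simp
  consider "snd w \<le> snd q" | "snd w > snd q" by linarith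
  then show ?case
  proof cases
    case w: 1
    then have "\<nexists>rs. refine w (q # ps) rs"
      using "1.IH" "1.prems" by simp
    moreover have "fits p w q \<longleftrightarrow>
        admissible (set (p # q # ps)) w \<and> snd p < snd w \<and> snd w < snd (last (q # ps))"
    proof
      assume fits: "fits p w q"
      \<comment> \<open>By column order the left vertex of the pattern can only be \<open>p\<close>
        and the right one only \<open>q\<close>, which \<open>fits\<close> excludes.\<close>
      have "\<not> {(fst w, snd w - 2), (fst w, snd w + 2)} \<subseteq> set (p # q # ps)"
      proof
        assume sub: "{(fst w, snd w - 2), (fst w, snd w + 2)} \<subseteq> set (p # q # ps)"
        have "(fst w, snd w - 2) \<notin> set (q # ps)"
          using le[of "(fst w, snd w - 2)"] fits by (auto simp: fits_def)
        moreover have "(fst w, snd w + 2) \<noteq> p"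
          using fits by (auto simp: fits_def)
        moreover have "(fst w, snd w + 2) \<notin> set ps"
          using "1.prems" fits by (force simp: fits_def)
        ultimately show False using sub fits by (auto simp: fits_def)
      qed
      moreover have "snd w < snd (last (q # ps))"
        using fits last unfolding fits_def by linarith
      moreover have "snd w + 2 \<le> snd r" if "r \<in> set (q # ps)" for r
        using le[OF that] fits by (simp add: fits_def)
      ultimately show "admissible (set (p # q # ps)) w \<and> snd p < snd w \<and> snd w < snd (last (q # ps))"
        using fits by (auto simp: admissible_def fits_def simp del: last.simps)
    next
      assume "admissible (set (p # q # ps)) w \<and> snd p < snd w \<and> snd w < snd (last (q # ps))"
      with w show "fits p w q" by (auto simp: admissible_def fits_def)
    qed
    ultimately show ?thesis using * by simp
  next
    case w: 2
    have p: "snd p + 2 \<le> snd q" using lt by simp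
    then have "p \<noteq> (fst w, snd w - 2)" "p \<noteq> (fst w, snd w + 2)" using w by auto
    then have "admissible (set (p # q # ps)) w \<longleftrightarrow> admissible (set (q # ps)) w"
      using p w by (auto simp: admissible_def)
    moreover have "\<not> fits p w q" using w by (simp add: fits_def)
    ultimately show ?thesis
      using * "1.IH" "1.prems" w p by simp
  qed
qed auto

text \<open>Induction on the total weight, which every move lowers: legal moves are the refinements,
  whose values have mex \<open>chain_value ps\<close>.\<close>

lemma nimber_switched_chain:
  "chain m ps \<Longrightarrow> nimber (switched (ladder m) (set ps)) = chain_value ps"
proof (induction "\<Sum>u\<in>pverts (ladder m). weight (switched (ladder m) (set ps)) u"
    arbitrary: ps rule: less_induct)
  case less
  let ?G = "ladder m"
  let ?P = "switched ?G (set ps)"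
  note chain = less.prems[unfolded chain_def]
  have toggle: "toggle_position ?P"
    by (rule toggle_position_switched[OF pair_graph_ladder])
  have fst_P [simp]: "fst (switched ?G M) = ?G" for M by (simp add: switched_def)
  have bounds: "1 \<le> snd p \<and> snd p \<le> m" if "p \<in> set ps" for p
  proof -
    have "snd (hd ps) \<le> snd p"
      using that chain by (cases ps) auto
    moreover have "snd p \<le> snd (last ps)"
      using that chain by (cases ps rule: rev_cases) (auto simp: sorted_wrt_append)
    ultimately show ?thesis using chain by simp
  qed
  have M: "set ps \<subseteq> {0..1} \<times> {1..m}" using bounds chain by auto
  have sep: "p = q \<or> snd p + 2 \<le> snd q \<or> snd q + 2 \<le> snd p"
    if "p \<in> set ps" "q \<in> set ps" for p q
    using that chain by (metis (no_types, lifting) in_set_conv_nth linorder_neqE_nat sorted_wrt_nth_less)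
  have ends: "hd ps \<in> set ps" "last ps \<in> set ps" "hd ps = (fst (hd ps), 1)" "last ps = (fst (last ps), m)"
    using chain by (auto simp: prod_eq_iff)
  have refine_iff: "(\<exists>rs. refine w ps rs) \<longleftrightarrow> w \<in> pverts ?G \<and> admissible (set ps) w" for w
  proof -
    have "snd (hd ps) < snd w \<and> snd w < snd (last ps) \<longleftrightarrow> snd w \<in> {1..m}"
      if "admissible (set ps) w"
    proof -
      have "snd p + 2 \<le> snd w \<or> snd w + 2 \<le> snd p" if "p \<in> set ps" for p
        using \<open>admissible (set ps) w\<close> that unfolding admissible_def by blast
      from this[OF ends(1)] this[OF ends(2)] chain show ?thesis by auto
    qed
    then show ?thesis
      using refine_iff_admissible[of ps w] chain
      by (auto simp: pverts_ladder mem_Times_iff admissible_def)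
  qed
  have legal: "legal_move ?P q \<longleftrightarrow> (\<exists>w. w \<in> pverts ?G \<and> admissible (set ps) w \<and> q = switch ?P w)" for q
    using legal_switched_ladder_iff[OF M sep] ends unfolding legal_move_def by (metis fst_P)
  have switch: "switch ?P w = switched ?G (set rs)" if "refine w ps rs" for w rs
  proof -
    have "w \<in> pverts ?G" "w \<notin> set ps"
      using refine_iff[of w] that by (auto simp: admissible_def)
    then show ?thesis by (simp add: set_refine[OF that] switch_switched[OF pair_graph_ladder])
  qed
  have "{q. legal_move ?P q} = {switched ?G (set rs) |w rs. refine w ps rs}"
    unfolding legal using refine_iff switch by (auto; metis)
  moreover have "nimber (switched ?G (set rs)) = chain_value rs" if "refine w ps rs" for w rs
  proof (rule less.hyps)
    have "legal_move ?P (switched ?G (set rs))"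
      unfolding legal using refine_iff[of w] that switch[OF that] by metis
    from total_weight_legal_move[OF toggle this]
    show "(\<Sum>u\<in>pverts ?G. weight (switched ?G (set rs)) u) < (\<Sum>u\<in>pverts ?G. weight ?P u)"
      by simp
  qed (rule chain_refine[OF that less.prems])
  then have "{nimber (switched ?G (set rs)) |w rs. refine w ps rs} =
      {chain_value rs |w rs. refine w ps rs}"
    by (intro Collect_cong) metis
  moreover have "{nimber q |q. legal_move ?P q} = nimber ` {q. legal_move ?P q}" by blast
  moreover have "nimber ` {switched ?G (set rs) |w rs. refine w ps rs} =
      {nimber (switched ?G (set rs)) |w rs. refine w ps rs}" by blast
  ultimately have "{nimber q |q. legal_move ?P q} = {chain_value rs |w rs. refine w ps rs}"
    by (simp only:)
  then show ?case
    using is_mex_chain_value[of ps] chain by (simp add: nimber_eq[OF toggle] mex_eqI)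
qed

section \<open>The nimbers of H and D as block values\<close>

lemma nimber_two_switches:
  assumes "m \<ge> 3" "a \<le> 1" "b \<le> 1"
  shows "nimber (switched (ladder m) {(a, 1), (b, m)}) = block_value (a = b) (m - 1)"
  using nimber_switched_chain[of m "[(a, 1), (b, m)]"] assms
  by (simp add: chain_def gap_value_def)

lemma switched_ladder_eqI:
  assumes "V \<subseteq> pverts (ladder m)" "M \<subseteq> {0..1} \<times> {1..m}"
    and "\<And>i j. i \<le> 1 \<Longrightarrow> 1 \<le> j \<Longrightarrow> j \<le> m \<Longrightarrow> (i, j) \<notin> V \<longleftrightarrow>
      ((i, j) \<in> M) = (((1 - i, j) \<in> M) = (((i, j - 1) \<in> M) = ((i, j + 1) \<in> M)))"
  shows "(ladder m, V) = switched (ladder m) M"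
proof -
  define V' where "V' = snd (switched (ladder m) M)"
  have V': "switched (ladder m) M = (ladder m, V')" by (simp add: V'_def switched_def)
  have "(i, j) \<in> V \<longleftrightarrow> (i, j) \<in> V'" if "(i, j) \<in> pverts (ladder m)" for i j
  proof -
    have v: "i \<le> 1" "1 \<le> j" "j \<le> m" using that by (auto simp: pverts_ladder)
    have "(i, j) \<notin> V' \<longleftrightarrow> weight (ladder m, V') (i, j) = 1" by (simp add: weight_def)
    also have "\<dots> \<longleftrightarrow> (i, j) \<notin> V"
      unfolding V'[symmetric] weight_switched_ladder[OF assms(2) v] assms(3)[OF v]
      by simp
    finally show ?thesis by blast
  qed
  moreover have "V' \<subseteq> pverts (ladder m)" by (auto simp: V'_def switched_def)
  ultimately have "V = V'" using assms(1) by auto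
  then show ?thesis by (simp add: V')
qed

text \<open>The zeros come from the closed neighborhoods of two corners in row 1. For
  \<open>m = 3\<close> these overlap in \<open>(1, 2)\<close>, which is switched twice; hence the
  special case.\<close>

lemma H_pos_eq_switched:
  assumes "m \<ge> 3"
  shows "H_pos m = switched (ladder m) {(1, 1), (1, m)}"
  unfolding H_pos_def
proof (rule switched_ladder_eqI, goal_cases)
  case 1
  then show ?case using toggle_position_H_pos[OF assms] by (simp add: toggle_position_def H_pos_def)
next
  case 2
  then show ?case using assms by auto
next
  case (3 i j)
  show ?case
  proof (cases "m = 3")
    case True
    with 3 have "i = 0 \<or> i = 1" "j = 1 \<or> j = 2 \<or> j = 3" by auto
    then show ?thesis using True by (elim disjE; simp)
  next
    case False
    show ?thesis
    proof (cases "i = 0")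
      case True
      then show ?thesis using 3 False by simp
    next
      case i: False
      have "j = 1 \<or> j = 2 \<or> j = m - 1 \<or> j = m \<or> 2 < j \<and> j < m - 1"
        using 3 by linarith
      moreover have "i = 1" "m \<ge> 4" using 3 i assms False by auto
      ultimately show ?thesis using 3 by (elim disjE; simp; presburger)
    qed
  qed
qed

text \<open>The corners lie in different rows, so their closed neighborhoods are disjoint even for
  \<open>m = 3\<close>.\<close>

lemma D_pos_eq_switched:
  assumes "m \<ge> 3"
  shows "D_pos m = switched (ladder m) {(1, 1), (0, m)}"
  unfolding D_pos_def
proof (rule switched_ladder_eqI, goal_cases)
  case 1
  then show ?case using toggle_position_D_pos[OF assms] by (simp add: toggle_position_def D_pos_def)
next
  case 2
  then show ?case using assms by auto
next
  case (3 i j)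
  then consider "i = 0" | "i = 1" by linarith
  then show ?case using 3 assms by cases (simp, presburger)+
qed

lemma nimber_H_pos: "m \<ge> 3 \<Longrightarrow> nimber (H_pos m) = block_value True (m - 1)"
  using nimber_two_switches[of m 1 1] by (simp add: H_pos_eq_switched)

lemma nimber_D_pos: "m \<ge> 3 \<Longrightarrow> nimber (D_pos m) = block_value False (m - 1)"
  using nimber_two_switches[of m 1 0] by (simp add: D_pos_eq_switched)

theorem proposition3p3:
  fixes m s :: nat and x y :: "nat \<Rightarrow> nat"
  assumes "m \<ge> 3"
    and "s = (m + 1) div 2"
    and "\<And>i. i \<in> {3..s} \<Longrightarrow>
      x i = xor (nimber (H_pos i)) (nimber (H_pos (m + 1 - i)))"
    and "\<And>i. i \<in> {3..s} \<Longrightarrow>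
      y i = xor (nimber (D_pos i)) (nimber (D_pos (m + 1 - i)))"
  shows "nimber (H_pos m) = mex (x ` {3..s} \<union> y ` {3..s})"
proof -
  \<comment> \<open>The value of a split at column \<open>i\<close>: the parts have \<open>i\<close>
    and \<open>m + 1 - i\<close> columns, one more than their gaps.\<close>
  define z where "z = (\<lambda>f i. xor (block_value f (i - 1)) (block_value f (m - i)))"
  \<comment> \<open>Both parts have the same type because the whole is \<open>H\<close>, so
    reflection swaps them and half of the columns suffice.\<close>
  have z_sym: "z f (m + 1 - i) = z f i" if "3 \<le> i" "i \<le> m - 2" for f i
    using that by (simp add: z_def xor.commute)
  have xz: "x ` {3..s} = z True ` {3..s}" and yz: "y ` {3..s} = z False ` {3..s}"
    using assms by (auto intro!: image_cong simp: nimber_H_pos nimber_D_pos z_def)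
  have half: "z f ` {3..m - 2} = z f ` {3..s}" for f
  proof (intro equalityI image_subsetI)
    fix i assume i: "i \<in> {3..m - 2}"
    show "z f i \<in> z f ` {3..s}"
    proof (cases "i \<le> s")
      case False
      then have "m + 1 - i \<in> {3..s}" using i assms(2) by auto
      then show ?thesis using z_sym[of i f] i by (metis atLeastAtMost_iff imageI)
    qed (use i in auto)
  next
    fix i assume "i \<in> {3..s}"
    then show "z f i \<in> z f ` {3..m - 2}" using assms(2) by auto
  qed
  \<comment> \<open>The recursion counts gaps from 2, the theorem columns from 3.\<close>
  have shift: "{2..m - 1 - 2} = (\<lambda>i. i - 1) ` {3..m - 2}"
  proof (intro equalityI subsetI)
    fix a assume "a \<in> {2..m - 1 - 2}"
    then show "a \<in> (\<lambda>i. i - 1) ` {3..m - 2}" by (intro image_eqI[of _ _ "a + 1"]) auto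
  qed auto
  have "(\<lambda>(f, a). xor (block_value f a) (block_value (f = True) (m - 1 - a))) ` (UNIV \<times> {2..m - 1 - 2})
      = z True ` {3..m - 2} \<union> z False ` {3..m - 2}"
    unfolding shift UNIV_bool by (force simp: z_def image_iff)
  then show ?thesis
    using assms(1) by (simp add: nimber_H_pos block_value.simps[of True] half xz yz)
qed

end
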